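(* Let $K$ be a compact, connected Hausdorff space and let $X$ be a real Banach space. Let $f\in C(K,X)$ be such that $M_f=K$ and $f(k)$ is a right symmetric point of $X$ for all $k\in K$. Then $f$ is a right symmetric point of $C(K,X)$.
   Context: $C(K,X)$ denotes the real Banach space of continuous functions $f:K\to X$ with the supremum norm $\|f\|=\sup_{k\in K}\|f(k)\|$. For $f\in C(K,X)$, $M_f=\{k\in K:\|f(k)\|=\|f\|\}$. In a real normed space $Y$, $x\perp_{BJ}y$ (Birkhoff-James orthogonality) means $\|x+\lambda y\|\ge\|x\|$ for all $\lambda\in\mathbb{R}$. An element $x\in Y$ is a right symmetric point of $Y$ if for all $y\in Y$, $y\perp_{BJ}x$ implies $x\perp_{BJ}y$. *)

theory Defs
  imports "HOL-Analysis.Analysis"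
begin

text \<open>
  For a compact space \<open>K\<close>, given as a type \<open>'k\<close>, the Banach space \<open>C(K,X)\<close> is rendered as
  the library type \<open>'k \<Rightarrow>\<^sub>C 'x\<close> of bounded continuous functions. The next two lemmas record
  that for compact \<open>K\<close> its elements are exactly the continuous functions \<open>K \<rightarrow> X\<close>, and
  that its norm is the supremum norm.
\<close>

lemma bcontfun_compact_iff:
  fixes f :: "'k::topological_space \<Rightarrow> 'x::metric_space"
  assumes "compact (UNIV :: 'k set)"
  shows "f \<in> bcontfun \<longleftrightarrow> continuous_on UNIV f"
  using assms by (auto simp: bcontfun_def intro: compact_imp_bounded compact_continuous_image)

lemma norm_bcontfun_eq_SUP:
  fixes f :: "'k::topological_space \<Rightarrow>\<^sub>C 'x::real_normed_vector"
  shows "norm f = (SUP k. norm (apply_bcontfun f k))"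
  by (simp add: norm_bcontfun_def dist_bcontfun.rep_eq)

definition norm_attaining_set ::
    "('k::topological_space \<Rightarrow>\<^sub>C 'x::real_normed_vector) \<Rightarrow> 'k set" where
  "norm_attaining_set f = {k. norm (apply_bcontfun f k) = norm f}"

definition bj_orthogonal :: "'a::real_normed_vector \<Rightarrow> 'a \<Rightarrow> bool" (infix "\<bottom>\<^sub>B\<^sub>J" 50) where
  "x \<bottom>\<^sub>B\<^sub>J y \<longleftrightarrow> (\<forall>c::real. norm (x + c *\<^sub>R y) \<ge> norm x)"

definition right_symmetric_point :: "'a::real_normed_vector \<Rightarrow> bool" where
  "right_symmetric_point x \<longleftrightarrow> (\<forall>y. y \<bottom>\<^sub>B\<^sub>J x \<longrightarrow> x \<bottom>\<^sub>B\<^sub>J y)"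

end

theory Submission
  imports Defs
begin

text \<open>
  Birkhoff--James orthogonality splits into two one-sided conditions, and the theorem already
  holds for each of the two. Say that \<open>y\<close> lies in the positive half of \<open>x\<close> if
  \<open>norm (x + t *\<^sub>R y) \<ge> norm x\<close> for all \<open>t \<ge> 0\<close>; then \<open>x \<bottom>\<^sub>B\<^sub>J y\<close> says that both \<open>y\<close> and
  \<open>-y\<close> lie in the positive half of \<open>x\<close>. Two facts carry the proof.

  A right symmetric point \<open>x\<close> is right symmetric for the one-sided relation as well
  (\<open>right_symmetric_point_one_sided\<close>): sliding \<open>y\<close> along \<open>-x\<close> to a point of minimal norm
  produces a vector orthogonal to \<open>x\<close>, and symmetry can be used there.

  In \<open>C(K,X)\<close> the one-sided relation is witnessed at a single point of \<open>K\<close>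
  (\<open>one_sided_orthogonal_at_point\<close>). This is a compactness argument, based on the convexity of
  \<open>t \<mapsto> norm (x + t *\<^sub>R y)\<close>. The two halves may have different witnesses.

  If now \<open>g \<bottom>\<^sub>B\<^sub>J f\<close>, there is a point \<open>k\<close> at which \<open>f k\<close> lies in the positive half of \<open>g k\<close>.
  By symmetry \<open>g k\<close> lies in the positive half of \<open>f k\<close>, and since \<open>f\<close> attains its norm at \<open>k\<close>,
  evaluation at \<open>k\<close> shows that \<open>g\<close> lies in the positive half of \<open>f\<close>. The same applied to \<open>-g\<close>
  gives the other half.
\<close>

lemma bj_orthogonal_minus_left:
  assumes "x \<bottom>\<^sub>B\<^sub>J y"
  shows "- x \<bottom>\<^sub>B\<^sub>J y"
  unfolding bj_orthogonal_def
proof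
  fix c :: real
  have "norm (- x + c *\<^sub>R y) = norm (x + (- c) *\<^sub>R y)"
    using norm_minus_cancel[of "x + (- c) *\<^sub>R y"] by simp
  then show "norm (- x) \<le> norm (- x + c *\<^sub>R y)"
    using assms unfolding bj_orthogonal_def by (metis norm_minus_cancel)
qed

text \<open>
  For \<open>x \<noteq> 0\<close> the map \<open>s \<mapsto> norm (y - s *\<^sub>R x)\<close> is continuous and exceeds \<open>norm y\<close> outside a bounded
  interval, so it has a minimum; the hypothesis rules out smaller values at negative \<open>s\<close>.
\<close>

lemma orthogonal_translate_exists:
  fixes x y :: "'a::real_normed_vector"
  assumes "\<And>t. t \<ge> 0 \<Longrightarrow> norm (y + t *\<^sub>R x) \<ge> norm y"
  obtains s where "s \<ge> 0" "(y - s *\<^sub>R x) \<bottom>\<^sub>B\<^sub>J x"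
proof (cases "x = 0")
  case True
  then have "(y - 0 *\<^sub>R x) \<bottom>\<^sub>B\<^sub>J x" by (simp add: bj_orthogonal_def)
  then show thesis using that by blast
next
  case False
  define R where "R = 2 * norm y / norm x"
  have "R \<ge> 0" by (simp add: R_def)
  have "continuous_on {0..R} (\<lambda>s. norm (y - s *\<^sub>R x))" by (intro continuous_intros)
  then obtain s where s: "s \<in> {0..R}"
    and min: "\<And>r. r \<in> {0..R} \<Longrightarrow> norm (y - s *\<^sub>R x) \<le> norm (y - r *\<^sub>R x)"
    using continuous_attains_inf[of "{0..R}" "\<lambda>s. norm (y - s *\<^sub>R x)"] \<open>R \<ge> 0\<close> by auto
  have le_y: "norm (y - s *\<^sub>R x) \<le> norm y" using min[of 0] \<open>R \<ge> 0\<close> by simp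
  have global_min: "norm (y - s *\<^sub>R x) \<le> norm (y - r *\<^sub>R x)" for r
  proof -
    consider "r < 0" | "r \<in> {0..R}" | "r > R" by fastforce
    then show ?thesis
    proof cases
      case 1
      then have "norm y \<le> norm (y - r *\<^sub>R x)" using assms[of "- r"] by simp
      with le_y show ?thesis by linarith
    next
      case 2
      then show ?thesis by (rule min)
    next
      case 3
      then have "2 * norm y \<le> norm (r *\<^sub>R x)"
        using False \<open>R \<ge> 0\<close> by (simp add: R_def[symmetric]) (simp add: R_def field_simps)
      moreover have "norm (r *\<^sub>R x) - norm y \<le> norm (y - r *\<^sub>R x)"
        by (metis norm_minus_commute norm_triangle_ineq2)
      ultimately show ?thesis using le_y by linarith
    qed
  qed
  have "(y - s *\<^sub>R x) \<bottom>\<^sub>B\<^sub>J x"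
    unfolding bj_orthogonal_def
  proof
    fix c
    show "norm (y - s *\<^sub>R x) \<le> norm (y - s *\<^sub>R x + c *\<^sub>R x)"
      using global_min[of "s - c"] by (simp add: algebra_simps)
  qed
  with s show thesis using that by auto
qed

text \<open>
  If \<open>z = y - s *\<^sub>R x\<close> is orthogonal to \<open>x\<close> with \<open>s \<ge> 0\<close>, then \<open>x \<bottom>\<^sub>B\<^sub>J z\<close>, and
  \<open>x + t *\<^sub>R y = (1 + t * s) *\<^sub>R x + t *\<^sub>R z\<close> has norm at least \<open>(1 + t * s) * norm x\<close>. The signs
  of \<open>s\<close> and \<open>t\<close> agree, so this is at least \<open>norm x\<close>.
\<close>

lemma right_symmetric_point_one_sided:
  fixes x y :: "'a::real_normed_vector"
  assumes "right_symmetric_point x"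
    and "\<And>t. t \<ge> 0 \<Longrightarrow> norm (y + t *\<^sub>R x) \<ge> norm y"
    and "t \<ge> 0"
  shows "norm (x + t *\<^sub>R y) \<ge> norm x"
proof -
  obtain s where s: "s \<ge> 0" and orth: "(y - s *\<^sub>R x) \<bottom>\<^sub>B\<^sub>J x"
    using orthogonal_translate_exists[OF assms(2)] by blast
  let ?z = "y - s *\<^sub>R x" and ?a = "1 + t * s"
  have a: "?a \<ge> 1" using s \<open>t \<ge> 0\<close> by simp
  have "x \<bottom>\<^sub>B\<^sub>J ?z" using assms(1) orth by (simp add: right_symmetric_point_def)
  then have "norm x \<le> norm (x + (t / ?a) *\<^sub>R ?z)" by (simp add: bj_orthogonal_def)
  then have "?a * norm x \<le> ?a * norm (x + (t / ?a) *\<^sub>R ?z)"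
    using a by (intro mult_left_mono) auto
  also have "\<dots> = norm (?a *\<^sub>R (x + (t / ?a) *\<^sub>R ?z))" using a by simp
  also have "?a *\<^sub>R (x + (t / ?a) *\<^sub>R ?z) = ?a *\<^sub>R x + t *\<^sub>R ?z"
    using a by (simp add: scaleR_add_right)
  also have "\<dots> = x + t *\<^sub>R y" by (simp add: algebra_simps)
  finally have "?a * norm x \<le> norm (x + t *\<^sub>R y)" .
  moreover have "1 * norm x \<le> ?a * norm x" using a by (intro mult_right_mono) auto
  ultimately show ?thesis by linarith
qed

lemma bcontfun_attains_norm:
  fixes f :: "'k::topological_space \<Rightarrow>\<^sub>C 'x::real_normed_vector"
  assumes "compact (UNIV :: 'k set)"
  obtains k where "norm (apply_bcontfun f k) = norm f"
proof -
  have "continuous_on UNIV (\<lambda>k. norm (apply_bcontfun f k))"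
    by (intro continuous_intros continuous_on_apply_bcontfun)
  then obtain k where "\<And>j. norm (apply_bcontfun f j) \<le> norm (apply_bcontfun f k)"
    using continuous_attains_sup[OF assms, of "\<lambda>k. norm (apply_bcontfun f k)"] by auto
  then have "norm f \<le> norm (apply_bcontfun f k)" by (rule norm_bound)
  then have "norm (apply_bcontfun f k) = norm f" using norm_bounded[of f k] by linarith
  then show thesis by (rule that)
qed

text \<open>
  Convexity of \<open>r \<mapsto> norm (x + r *\<^sub>R y)\<close>: starting at or below the level \<open>b\<close> and reaching it at
  \<open>s\<close>, the map cannot be below \<open>b\<close> later.
\<close>

lemma norm_line_stays_above:
  fixes x y :: "'a::real_normed_vector"
  assumes "norm x \<le> b" "b \<le> norm (x + s *\<^sub>R y)" "0 < s" "s \<le> t"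
  shows "b \<le> norm (x + t *\<^sub>R y)"
proof -
  have "x + s *\<^sub>R y = (1 - s / t) *\<^sub>R x + (s / t) *\<^sub>R (x + t *\<^sub>R y)"
    using assms by (simp add: algebra_simps)
  then have "norm (x + s *\<^sub>R y) \<le> (1 - s / t) * norm x + (s / t) * norm (x + t *\<^sub>R y)"
    using norm_triangle_ineq[of "(1 - s / t) *\<^sub>R x" "(s / t) *\<^sub>R (x + t *\<^sub>R y)"] assms by simp
  also have "\<dots> \<le> (1 - s / t) * b + (s / t) * norm (x + t *\<^sub>R y)"
    using assms by (intro add_right_mono mult_left_mono) auto
  finally have "(s / t) * b \<le> (s / t) * norm (x + t *\<^sub>R y)"
    using assms(2) by (simp add: algebra_simps)
  moreover have "s / t > 0" using assms by simp
  ultimately show ?thesis by (simp only: mult_le_cancel_left_pos)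
qed

text \<open>
  The closed sets of points where \<open>norm (g k + t *\<^sub>R f k) \<ge> norm g\<close>, for \<open>t > 0\<close>, are nonempty
  because \<open>g + t *\<^sub>R f\<close> attains its norm, and they increase with \<open>t\<close> by convexity. By
  compactness they have a common point.
\<close>

lemma one_sided_orthogonal_at_point:
  fixes f g :: "'k::topological_space \<Rightarrow>\<^sub>C 'x::real_normed_vector"
  assumes compact: "compact (UNIV :: 'k set)"
    and orth: "\<And>t. t \<ge> 0 \<Longrightarrow> norm (g + t *\<^sub>R f) \<ge> norm g"
  obtains k where "\<And>t. t \<ge> 0 \<Longrightarrow>
    norm (apply_bcontfun g k + t *\<^sub>R apply_bcontfun f k) \<ge> norm (apply_bcontfun g k)"
proof -
  define A where "A t = {k. norm g \<le> norm (apply_bcontfun g k + t *\<^sub>R apply_bcontfun f k)}" for t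
  have closed: "closed (A t)" for t
    unfolding A_def by (intro closed_Collect_le continuous_intros continuous_on_apply_bcontfun)
  have nonempty: "A t \<noteq> {}" if "t > 0" for t
  proof -
    obtain k where "norm (apply_bcontfun (g + t *\<^sub>R f) k) = norm (g + t *\<^sub>R f)"
      using bcontfun_attains_norm[OF compact] by blast
    then have "k \<in> A t"
      using orth[of t] that by (simp add: A_def plus_bcontfun.rep_eq scaleR_bcontfun.rep_eq)
    then show ?thesis by blast
  qed
  have mono: "A s \<subseteq> A t" if "0 < s" "s \<le> t" for s t
    using norm_line_stays_above[OF norm_bounded _ that] by (auto simp: A_def)
  have "UNIV \<inter> (\<Inter>t\<in>{0<..}. A t) \<noteq> {}"
  proof (rule compact_imp_fip_image[OF compact])
    show "closed (A t)" if "t \<in> {0<..}" for t by (rule closed)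
  next
    fix T :: "real set"
    assume T: "finite T" "T \<subseteq> {0<..}"
    show "UNIV \<inter> (\<Inter>t\<in>T. A t) \<noteq> {}"
    proof (cases "T = {}")
      case False
      then have "Min T > 0" using T by (metis Min_in greaterThan_iff subsetD)
      moreover have "A (Min T) \<subseteq> A t" if "t \<in> T" for t
        using mono[OF \<open>Min T > 0\<close>] T that by simp
      ultimately show ?thesis using nonempty[of "Min T"] by blast
    qed simp
  qed
  then obtain k where k: "\<And>t. t > 0 \<Longrightarrow> k \<in> A t" by auto
  have "norm (apply_bcontfun g k) \<le> norm (apply_bcontfun g k + t *\<^sub>R apply_bcontfun f k)"
    if "t \<ge> 0" for t
  proof (cases "t = 0")
    case False
    then show ?thesis using k[of t] that norm_bounded[of g k] by (simp add: A_def)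
  qed simp
  then show thesis by (rule that)
qed

lemma pointwise_right_symmetric_one_sided:
  fixes f g :: "'k::topological_space \<Rightarrow>\<^sub>C 'x::real_normed_vector"
  assumes compact: "compact (UNIV :: 'k set)"
    and attains: "norm_attaining_set f = UNIV"
    and sym: "\<And>k. right_symmetric_point (apply_bcontfun f k)"
    and orth: "\<And>r. r \<ge> 0 \<Longrightarrow> norm (g + r *\<^sub>R f) \<ge> norm g"
    and "t \<ge> 0"
  shows "norm (f + t *\<^sub>R g) \<ge> norm f"
proof -
  obtain k where "\<And>r. r \<ge> 0 \<Longrightarrow>
      norm (apply_bcontfun g k + r *\<^sub>R apply_bcontfun f k) \<ge> norm (apply_bcontfun g k)"
    using one_sided_orthogonal_at_point[OF compact orth] by blast
  then have "norm (apply_bcontfun f k) \<le> norm (apply_bcontfun f k + t *\<^sub>R apply_bcontfun g k)"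
    using right_symmetric_point_one_sided[OF sym] \<open>t \<ge> 0\<close> by blast
  also have "\<dots> \<le> norm (f + t *\<^sub>R g)"
    using norm_bounded[of "f + t *\<^sub>R g" k] by (simp add: plus_bcontfun.rep_eq scaleR_bcontfun.rep_eq)
  finally have "norm (apply_bcontfun f k) \<le> norm (f + t *\<^sub>R g)" .
  moreover have "norm (apply_bcontfun f k) = norm f"
    using attains by (auto simp: norm_attaining_set_def)
  ultimately show ?thesis by simp
qed

theorem theorem2p9:
  fixes f :: "'k::t2_space \<Rightarrow>\<^sub>C 'x::banach"
  assumes "compact (UNIV :: 'k set)"
    and "connected (UNIV :: 'k set)"
    and "norm_attaining_set f = UNIV"
    and "\<And>k. right_symmetric_point (apply_bcontfun f k)"
  shows "right_symmetric_point f"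
  unfolding right_symmetric_point_def
proof (intro allI impI)
  fix g :: "'k \<Rightarrow>\<^sub>C 'x"
  assume g: "g \<bottom>\<^sub>B\<^sub>J f"
  have half: "norm f \<le> norm (f + t *\<^sub>R h)" if "h \<bottom>\<^sub>B\<^sub>J f" "t \<ge> 0" for h t
    using pointwise_right_symmetric_one_sided[OF assms(1,3,4) _ that(2), of h] that(1)
    by (simp add: bj_orthogonal_def)
  show "f \<bottom>\<^sub>B\<^sub>J g"
    unfolding bj_orthogonal_def
  proof
    fix c :: real
    show "norm f \<le> norm (f + c *\<^sub>R g)"
    proof (cases "c \<ge> 0")
      case True
      with g show ?thesis by (rule half)
    next
      case False
      then have "norm f \<le> norm (f + (- c) *\<^sub>R (- g))"
        by (intro half bj_orthogonal_minus_left g) simp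
      then show ?thesis by simp
    qed
  qed
qed

end
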